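(* Let $m\in\mathbb N$, $\varepsilon\in(0,\varepsilon^*]$ and $u_0^{\varepsilon,m}\in B^m_{r^*}$. Then the truncated scheme in $\mathbb C^{2m+1}$ $$u_n^{\varepsilon,m}=u_{n-1}^{\varepsilon,m}+\varepsilon\big((\lambda+i\mu)\Lambda_mu_n^{\varepsilon,m}-(\gamma+i\beta)u_n^{\varepsilon,m}-(k+i\nu)|u_n^{\varepsilon,m}|^pu_n^{\varepsilon,m}+g^m\big),\qquad n\in\mathbb N,$$ possesses a unique solution with $u_n^{\varepsilon,m}\in B^m_{r^*}$ for all $n\in\mathbb N$. Furthermore, the solution semigroup $y\mapsto u_n^{\varepsilon,m}(y)$ on $B^m_{r^*}$ has a unique (finite-dimensional numerical) attractor $\mathcal A_m^\varepsilon$, given by $$\mathcal A_m^\varepsilon=\bigcap_{N=1}^\infty\overline{\bigcup_{n=N}^\infty u_n^{\varepsilon,m}(B^m_{r^*})}.$$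
   Context: Parameters: $\lambda,\gamma,k,p>0$, $\mu,\beta,\nu\in\mathbb R$, with $\gamma>4\lambda$; $g=(g_j)_{j\in\mathbb Z}$ is a complex sequence with $\|g\|_{(p+2)/(p+1)}<\infty$ (hence $g\in\ell^2$), where $\|u\|_q^q=\sum_j|u_j|^q$ and $\|\cdot\|=\|\cdot\|_2$. Elements of $\mathbb C^{2m+1}$ are written $z=(z_j)_{|j|\le m}$, with Euclidean norm $\|\cdot\|$; $|z|^pz=(|z_j|^pz_j)_{|j|\le m}$; $g^m=(g_j)_{|j|\le m}$; $B_r^m=\{z\in\mathbb C^{2m+1}:\|z\|\le r\}$. $\Lambda_m$ is the $(2m+1)\times(2m+1)$ periodic matrix $(\Lambda_mz)_j=-z_{j-1}+2z_j-z_{j+1}$ for $|j|\le m$ with the convention $z_{-m-1}=z_m$, $z_{m+1}=z_{-m}$. $B_r=\{u\in\ell^2:\|u\|\le r\}$, where $\ell^2$ is the space of complex square-summable sequences indexed by $\mathbb Z$. $C_p>0$ is a constant depending only on $p$ such that $\||u|^pu-|v|^pv\|\le C_pr^p\|u-v\|$ for all $r>0$, $u,v\in B_r$. For $r>0$, $M_r=(4\lambda+4|\mu|+\gamma+|\beta|)r+(k+|\nu|)r^{p+1}+\|g\|$ and $L_r=4\lambda+4|\mu|+\gamma+|\beta|+C_pr^p(k+|\nu|)$. Fix $\eta\ge0$ and set $$c_1=\frac{p+1}{p+2}\,\frac{1}{[k(p+2)]^{1/(p+1)}}\,\|g\|_{\frac{p+2}{p+1}}^{\frac{p+2}{p+1}},\quad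 r^*=\sqrt{\eta+\frac{c_1}{\gamma-4\lambda}},\quad \varepsilon^*=\min\Big\{\frac1{M_{r^*+1}},\frac1{1+L_{r^*+1}}\Big\}.$$ An attractor of the solution semigroup on $B^m_{r^*}$ is a compact set $\mathcal A\subset B^m_{r^*}$ with $u_n^{\varepsilon,m}(\mathcal A)=\mathcal A$ for all $n\in\mathbb N$ and $\sup_{y\in B^m_{r^*}}\inf_{a\in\mathcal A}\|u_n^{\varepsilon,m}(y)-a\|\to0$ as $n\to\infty$. *)

theory Defs
  imports "HOL-Analysis.Analysis"
begin

definition ell :: "real \<Rightarrow> (int \<Rightarrow> complex) set"
  where "ell q = {u. (\<lambda>j. norm (u j) powr q) summable_on UNIV}"

definition ell_norm :: "real \<Rightarrow> (int \<Rightarrow> complex) \<Rightarrow> real"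
  where "ell_norm q u = (\<Sum>\<^sub>\<infinity>j. norm (u j) powr q) powr (1 / q)"

definition ell2_ball :: "real \<Rightarrow> (int \<Rightarrow> complex) set"
  where "ell2_ball r = {u \<in> ell 2. ell_norm 2 u \<le> r}"

definition pow_nonlin :: "real \<Rightarrow> complex \<Rightarrow> complex"
  where "pow_nonlin p w = of_real (norm w powr p) * w"

text \<open>The admissible constants \<open>C\<^sub>p\<close>; the condition involves no parameter other than \<open>p\<close>.\<close>

definition pow_Lipschitz_const :: "real \<Rightarrow> real \<Rightarrow> bool"
  where "pow_Lipschitz_const p C \<longleftrightarrow>
    C > 0 \<and>
    (\<forall>r>0. \<forall>u\<in>ell2_ball r. \<forall>v\<in>ell2_ball r.
       ell_norm 2 (\<lambda>j. pow_nonlin p (u j) - pow_nonlin p (v j))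
         \<le> C * r powr p * ell_norm 2 (\<lambda>j. u j - v j))"

definition M_bound ::
  "real \<Rightarrow> real \<Rightarrow> real \<Rightarrow> real \<Rightarrow> real \<Rightarrow> real \<Rightarrow> real \<Rightarrow> (int \<Rightarrow> complex) \<Rightarrow> real \<Rightarrow> real"
  where "M_bound lam \<mu> \<gamma> \<beta> k \<nu> p g r =
    (4 * lam + 4 * \<bar>\<mu>\<bar> + \<gamma> + \<bar>\<beta>\<bar>) * r + (k + \<bar>\<nu>\<bar>) * r powr (p + 1) + ell_norm 2 g"

definition L_bound ::
  "real \<Rightarrow> real \<Rightarrow> real \<Rightarrow> real \<Rightarrow> real \<Rightarrow> real \<Rightarrow> real \<Rightarrow> real \<Rightarrow> real \<Rightarrow> real"
  where "L_bound lam \<mu> \<gamma> \<beta> k \<nu> p C r =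
    4 * lam + 4 * \<bar>\<mu>\<bar> + \<gamma> + \<bar>\<beta>\<bar> + C * r powr p * (k + \<bar>\<nu>\<bar>)"

definition c_one :: "real \<Rightarrow> real \<Rightarrow> (int \<Rightarrow> complex) \<Rightarrow> real"
  where "c_one k p g =
    (p + 1) / (p + 2) * (1 / (k * (p + 2)) powr (1 / (p + 1)))
      * ell_norm ((p + 2) / (p + 1)) g powr ((p + 2) / (p + 1))"

definition r_star :: "real \<Rightarrow> real \<Rightarrow> real \<Rightarrow> real \<Rightarrow> (int \<Rightarrow> complex) \<Rightarrow> real \<Rightarrow> real"
  where "r_star lam \<gamma> k p g \<eta> = sqrt (\<eta> + c_one k p g / (\<gamma> - 4 * lam))"

definition eps_star ::
  "real \<Rightarrow> real \<Rightarrow> real \<Rightarrow> real \<Rightarrow> real \<Rightarrow> real \<Rightarrow> real \<Rightarrow> (int \<Rightarrow> complex) \<Rightarrow> real \<Rightarrow> real \<Rightarrow> real"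
  where "eps_star lam \<mu> \<gamma> \<beta> k \<nu> p g C \<eta> =
    min (1 / M_bound lam \<mu> \<gamma> \<beta> k \<nu> p g (r_star lam \<gamma> k p g \<eta> + 1))
        (1 / (1 + L_bound lam \<mu> \<gamma> \<beta> k \<nu> p C (r_star lam \<gamma> k p g \<eta> + 1)))"

text \<open>
  The space of vectors \<open>(z\<^sub>j)\<close> with \<open>\<bar>j\<bar> \<le> m\<close> is rendered as \<^typ>\<open>complex ^ 'n\<close> together with a
  labelling \<open>ix :: 'n \<Rightarrow> int\<close> that is a bijection onto \<open>{- int m..int m}\<close>; \<open>coord ix z j\<close> is \<open>z\<^sub>j\<close>.
  The norm of \<^typ>\<open>complex ^ 'n\<close> is the Euclidean one.
\<close>

definition coord :: "('n::finite \<Rightarrow> int) \<Rightarrow> complex ^ 'n \<Rightarrow> int \<Rightarrow> complex"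
  where "coord ix z j = z $ inv ix j"

text \<open>The convention \<open>z\<^sub>-\<^sub>m\<^sub>-\<^sub>1 = z\<^sub>m\<close>, \<open>z\<^sub>m\<^sub>+\<^sub>1 = z\<^sub>-\<^sub>m\<close>.\<close>

definition wrap :: "nat \<Rightarrow> int \<Rightarrow> int"
  where "wrap m j =
    (if j = - int m - 1 then int m else if j = int m + 1 then - int m else j)"

definition periodic_Lambda :: "nat \<Rightarrow> ('n::finite \<Rightarrow> int) \<Rightarrow> complex ^ 'n \<Rightarrow> complex ^ 'n"
  where "periodic_Lambda m ix z =
    (\<chi> i. - coord ix z (wrap m (ix i - 1)) + 2 * coord ix z (ix i)
          - coord ix z (wrap m (ix i + 1)))"

definition scheme_field ::
  "real \<Rightarrow> real \<Rightarrow> real \<Rightarrow> real \<Rightarrow> real \<Rightarrow> real \<Rightarrow> real \<Rightarrow> (int \<Rightarrow> complex) \<Rightarrow>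
   nat \<Rightarrow> ('n::finite \<Rightarrow> int) \<Rightarrow> complex ^ 'n \<Rightarrow> complex ^ 'n"
  where "scheme_field lam \<mu> \<gamma> \<beta> k \<nu> p g m ix z =
    Complex lam \<mu> *s periodic_Lambda m ix z
      - Complex \<gamma> \<beta> *s z
      - Complex k \<nu> *s (\<chi> i. pow_nonlin p (z $ i))
      + (\<chi> i. g (ix i))"

definition scheme_solution ::
  "('a::real_normed_vector \<Rightarrow> 'a) \<Rightarrow> real \<Rightarrow> 'a \<Rightarrow> (nat \<Rightarrow> 'a) \<Rightarrow> bool"
  where "scheme_solution F \<epsilon> y u \<longleftrightarrow>
    u 0 = y \<and> (\<forall>n\<ge>1. u n = u (n - 1) + \<epsilon> *\<^sub>R F (u n))"

text \<open>Meaningful at those \<open>y\<close> from which there is exactly one solution.\<close>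

definition solution_map ::
  "('a::real_normed_vector \<Rightarrow> 'a) \<Rightarrow> real \<Rightarrow> nat \<Rightarrow> 'a \<Rightarrow> 'a"
  where "solution_map F \<epsilon> n y = (THE u. scheme_solution F \<epsilon> y u) n"

text \<open>
  Distances are taken in \<^typ>\<open>ennreal\<close> so that the infimum over the empty set is \<open>\<infinity>\<close>;
  the empty set therefore does not attract a nonempty \<open>B\<close>.
\<close>

definition is_attractor ::
  "(nat \<Rightarrow> 'a::real_normed_vector \<Rightarrow> 'a) \<Rightarrow> 'a set \<Rightarrow> 'a set \<Rightarrow> bool"
  where "is_attractor S B A \<longleftrightarrow>
    compact A \<and> A \<subseteq> B \<and> (\<forall>n. S n ` A = A) \<and>
    (\<lambda>n. SUP y\<in>B. INF a\<in>A. ennreal (norm (S n y - a))) \<longlonglongrightarrow> 0"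

end

theory Submission
  imports Defs
begin

text \<open>
  The scheme is the implicit Euler method for a dissipative field \<open>F\<close> on a finite-dimensional space,
  and one step asks for \<open>z = x + \<epsilon> *\<^sub>R F z\<close>.

  Pairing the step with \<open>z\<close> gives an a priori estimate. The imaginary coefficients do not contribute,
  because the periodic matrix is self-adjoint and the nonlinearity is a real multiple of \<open>z\<close> in every
  coordinate. The matrix adds at most \<open>4 * lam * (norm z)\<^sup>2\<close>, which the linear damping dominates, and
  Young's inequality lets the nonlinear damping absorb the forcing at the cost of the constant
  \<open>c_one\<close>. Hence \<open>F z \<bullet> z \<le> c_one k p g - (\<gamma> - 4 * lam) * (norm z)\<^sup>2\<close>
  (\<open>scheme_field_dissipative\<close>), and with the chosen radius every solution \<open>z\<close> with
  \<open>x\<close> in the ball lies in the ball too (\<open>dissipative_step_in_ball\<close>).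

  On the ball whose radius is larger by \<open>1\<close> the field is bounded by \<open>M_bound\<close> and has the Lipschitz
  constant \<open>L_bound\<close> (\<open>norm_scheme_field_le\<close>, \<open>scheme_field_lipschitz\<close>). The bound on \<open>\<epsilon>\<close>
  therefore makes \<open>z \<mapsto> x + \<epsilon> *\<^sub>R F z\<close> a contraction of that larger ball, which gives existence.
  Uniqueness holds in the whole space, since the a priori estimate confines all solutions to the region
  where the contraction estimate applies.

  So the scheme is the iteration of one continuous map of a compact ball into itself
  (\<open>implicit_scheme_attractor\<close>). For such a map the intersection of the nested images of the ball is
  invariant and attracts the ball, by compactness, and any two attractors contain each other.
\<close>

section \<open>Attractors of continuous self-maps of compact sets\<close>

lemma funpow_image_subset:
  assumes "f ` B \<subseteq> B"
  shows "(f ^^ n) ` B \<subseteq> B"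
  using assms by (induction n) auto

text \<open>The iterated images of a set that \<open>f\<close> maps into itself are nested; every compactness argument about
  the attractor is applied to this nest.\<close>

lemma funpow_image_antimono:
  assumes "f ` B \<subseteq> B" "m \<le> n"
  shows "(f ^^ n) ` B \<subseteq> (f ^^ m) ` B"
proof -
  obtain d where "n = m + d"
    using assms(2) le_Suc_ex by blast
  then have "(f ^^ n) ` B = (f ^^ m) ` ((f ^^ d) ` B)"
    by (simp add: funpow_add image_comp)
  then show ?thesis
    using funpow_image_subset[OF assms(1), of d] by auto
qed

lemma continuous_on_funpow:
  assumes "continuous_on B f" "f ` B \<subseteq> B"
  shows "continuous_on B (f ^^ n)"
proof (induction n)
  case (Suc n)
  have "continuous_on ((f ^^ n) ` B) f"
    using assms(1) funpow_image_subset[OF assms(2)] continuous_on_subset by blast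
  then show ?case
    using continuous_on_compose[OF Suc] by simp
qed (simp add: id_def)

lemma compact_funpow_image:
  assumes "compact B" "continuous_on B f" "f ` B \<subseteq> B"
  shows "compact ((f ^^ n) ` B)"
  using compact_continuous_image[OF continuous_on_funpow[OF assms(2,3)] assms(1)] .

lemma compact_nest_subset_open:
  fixes K :: "nat \<Rightarrow> 'a::heine_borel set"
  assumes "\<And>n. compact (K n)" "\<And>m n. m \<le> n \<Longrightarrow> K n \<subseteq> K m" "open U" "(\<Inter>n. K n) \<subseteq> U"
  shows "\<exists>N. K N \<subseteq> U"
proof (rule ccontr)
  assume "\<nexists>N. K N \<subseteq> U"
  then have "(\<Inter>n. K n - U) \<noteq> {}"
    using assms by (intro compact_nest compact_diff) blast+
  then show False
    using assms(4) by blast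
qed

text \<open>The images themselves are intersected, without closures or tails of the orbit; for a continuous
  self-map of a compact set the two constructions agree.\<close>

definition omega_limit :: "('a \<Rightarrow> 'a) \<Rightarrow> 'a set \<Rightarrow> 'a set"
  where "omega_limit f B = (\<Inter>n. (f ^^ n) ` B)"

text \<open>For compact \<open>B\<close> this nested intersection is invariant. The inclusion from right to left needs
  compactness: a point \<open>y\<close> of the intersection has a preimage in each \<open>(f ^^ n) ` B\<close>, and those
  preimages form a nest of nonempty compact sets, so one point serves for all \<open>n\<close>.\<close>

lemma image_omega_limit:
  fixes B :: "'a::heine_borel set"
  assumes "compact B" "continuous_on B f" "f ` B \<subseteq> B"
  shows "f ` omega_limit f B = omega_limit f B"
proof (intro equalityI subsetI)
  fix y assume "y \<in> f ` omega_limit f B"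
  then obtain x where x: "\<And>n. x \<in> (f ^^ n) ` B" "y = f x"
    by (auto simp: omega_limit_def)
  have "y \<in> (f ^^ n) ` B" for n
  proof -
    have "y \<in> (f ^^ Suc n) ` B"
      using x(1)[of n] x(2) by (auto simp: image_iff)
    then show ?thesis
      using funpow_image_antimono[OF assms(3), of n "Suc n"] by auto
  qed
  then show "y \<in> omega_limit f B"
    by (simp add: omega_limit_def)
next
  fix y assume y: "y \<in> omega_limit f B"
  define K where "K n = (f ^^ n) ` B \<inter> f -` {y}" for n
  have sub: "(f ^^ n) ` B \<subseteq> B" for n
    using funpow_image_subset[OF assms(3)] .
  have cpt: "compact ((f ^^ n) ` B)" for n
    using compact_funpow_image[OF assms(1-3)] .
  have "compact (K n)" for n
  proof -
    have "closed (K n)"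
      unfolding K_def using continuous_on_subset[OF assms(2) sub] cpt
      by (intro continuous_closed_preimage) (auto simp: compact_imp_closed)
    then show ?thesis
      using cpt[of n] compact_Int_closed[of "(f ^^ n) ` B" "K n"]
      by (simp add: K_def Int_absorb1 flip: Int_assoc)
  qed
  moreover have "K n \<noteq> {}" for n
  proof -
    have "y \<in> (f ^^ Suc n) ` B"
      using y by (auto simp only: omega_limit_def)
    then show ?thesis
      by (auto simp: K_def)
  qed
  moreover have "K n \<subseteq> K m" if "m \<le> n" for m n
    using funpow_image_antimono[OF assms(3) that] by (auto simp: K_def)
  ultimately have "(\<Inter>n. K n) \<noteq> {}"
    by (rule compact_nest)
  then show "y \<in> f ` omega_limit f B"
    by (auto simp: K_def omega_limit_def)
qed

text \<open>Attraction is uniform over \<open>B\<close> by compactness: for each radius the open neighbourhood of the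
  intersection contains a whole image \<open>(f ^^ N) ` B\<close>, hence all later ones.\<close>

theorem is_attractor_omega_limit:
  fixes B :: "'a::{real_normed_vector, heine_borel} set"
  assumes "compact B" "continuous_on B f" "f ` B \<subseteq> B"
    and S: "\<And>n y. y \<in> B \<Longrightarrow> S n y = (f ^^ n) y"
  shows "is_attractor S B (omega_limit f B)"
proof -
  let ?A = "omega_limit f B"
  have cpt: "compact ((f ^^ n) ` B)" for n
    using compact_funpow_image[OF assms(1-3)] .
  have "compact ?A"
    unfolding omega_limit_def using cpt by (intro compact_Inter) auto
  have AB: "?A \<subseteq> B"
    unfolding omega_limit_def using INT_lower[of 0 UNIV "\<lambda>n. (f ^^ n) ` B"] by simp
  have "(f ^^ n) ` ?A = ?A" for n
  proof (induction n)
    case (Suc n)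
    have "(f ^^ Suc n) ` ?A = f ` ((f ^^ n) ` ?A)"
      by (simp add: image_comp)
    then show ?case
      using Suc image_omega_limit[OF assms(1-3)] by simp
  qed simp
  then have inv: "S n ` ?A = ?A" for n
    using AB S by (metis (no_types, lifting) image_cong subsetD)
  have "(\<lambda>n. SUP y\<in>B. INF a\<in>?A. ennreal (norm (S n y - a))) \<longlonglongrightarrow> 0"
  proof (rule order_tendstoI)
    fix c :: ennreal assume "0 < c"
    then obtain c' where c': "0 < c'" "c' < c"
      using dense by blast
    then obtain e where e: "c' = ennreal e" "e > 0"
      by (cases c') auto
    let ?U = "\<Union>a\<in>?A. ball a e"
    have "\<exists>N. (f ^^ N) ` B \<subseteq> ?U"
    proof (rule compact_nest_subset_open)
      show "(\<Inter>n. (f ^^ n) ` B) \<subseteq> ?U"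
        using e(2) unfolding omega_limit_def[symmetric] by auto
    qed (use cpt funpow_image_antimono[OF assms(3)] in auto)
    then obtain N where N: "(f ^^ N) ` B \<subseteq> ?U" ..
    have "(SUP y\<in>B. INF a\<in>?A. ennreal (norm (S n y - a))) < c" if "n \<ge> N" for n
    proof (rule le_less_trans[OF SUP_least c'(2)])
      fix y assume "y \<in> B"
      then have "S n y \<in> (f ^^ n) ` B"
        using S by simp
      then have "S n y \<in> ?U"
        using N funpow_image_antimono[OF assms(3) that] by (meson subsetD)
      then obtain a where "a \<in> ?A" "norm (S n y - a) \<le> e"
        by (force simp: dist_norm norm_minus_commute)
      then show "(INF a\<in>?A. ennreal (norm (S n y - a))) \<le> c'"
        unfolding e(1) by (meson INF_lower2 ennreal_leI)
    qed
    then show "\<forall>\<^sub>F n in sequentially. (SUP y\<in>B. INF a\<in>?A. ennreal (norm (S n y - a))) < c"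
      by (auto simp: eventually_sequentially)
  qed simp
  with \<open>compact ?A\<close> AB inv show ?thesis
    by (simp add: is_attractor_def)
qed

text \<open>Applied in both directions this gives uniqueness. A point \<open>a\<close> of \<open>A = S n ` A\<close> is an image
  \<open>S n y\<close> with \<open>y \<in> B\<close> for every \<open>n\<close>, so its distance from \<open>A'\<close> is below a quantity that
  tends to \<open>0\<close>; and \<open>A'\<close> is closed.\<close>

lemma is_attractor_subset:
  assumes "is_attractor S B A" "is_attractor S B A'"
  shows "A \<subseteq> A'"
proof
  fix a assume "a \<in> A"
  let ?d = "INF b\<in>A'. ennreal (norm (a - b))"
  have "?d \<le> (SUP y\<in>B. INF b\<in>A'. ennreal (norm (S n y - b)))" for n
  proof -
    obtain y where y: "y \<in> A" "a = S n y"
      using assms(1) \<open>a \<in> A\<close> unfolding is_attractor_def by (metis imageE)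
    then have "y \<in> B"
      using assms(1) unfolding is_attractor_def by blast
    then show ?thesis
      unfolding y(2) by (rule SUP_upper)
  qed
  then have "?d \<le> 0"
    using assms(2) unfolding is_attractor_def by (intro LIMSEQ_le_const) auto
  then have "\<exists>b\<in>A'. dist b a < e" if "e > 0" for e
    using that INF_less_iff[of "\<lambda>b. ennreal (norm (a - b))" A' "ennreal e"]
    by (auto simp: dist_norm norm_minus_commute ennreal_less_iff)
  then have "a \<in> closure A'"
    by (simp add: closure_approachable)
  then show "a \<in> A'"
    using assms(2) by (simp add: is_attractor_def compact_imp_closed)
qed

text \<open>The unions over \<open>n \<ge> N\<close> collapse to their first member \<open>(f ^^ N) ` B\<close>, which is already closed.\<close>

lemma omega_limit_eq_INT_closure:
  fixes B :: "'a::heine_borel set"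
  assumes "compact B" "continuous_on B f" "f ` B \<subseteq> B"
    and S: "\<And>n y. y \<in> B \<Longrightarrow> S n y = (f ^^ n) y"
  shows "(\<Inter>N\<in>{1..}. closure (\<Union>n\<in>{N..}. S n ` B)) = omega_limit f B"
proof -
  have im: "S n ` B = (f ^^ n) ` B" for n
    using S by (intro image_cong) auto
  have "(\<Union>n\<in>{N..}. S n ` B) = (f ^^ N) ` B" for N
  proof
    show "(\<Union>n\<in>{N..}. S n ` B) \<subseteq> (f ^^ N) ` B"
      unfolding im by (intro UN_least funpow_image_antimono[OF assms(3)]) simp
    show "(f ^^ N) ` B \<subseteq> (\<Union>n\<in>{N..}. S n ` B)"
      unfolding im by (rule UN_upper) simp
  qed
  moreover have "closed ((f ^^ N) ` B)" for N
    using compact_imp_closed[OF compact_funpow_image[OF assms(1-3)]] .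
  ultimately have "(\<Inter>N\<in>{1..}. closure (\<Union>n\<in>{N..}. S n ` B)) = (\<Inter>N\<in>{1..}. (f ^^ N) ` B)"
    by simp
  also have "\<dots> = omega_limit f B"
  proof (intro equalityI subsetI)
    fix x assume x: "x \<in> (\<Inter>N\<in>{1..}. (f ^^ N) ` B)"
    have "x \<in> (f ^^ N) ` B" for N
    proof -
      have "x \<in> (f ^^ Suc N) ` B"
        using x by (rule INT_D) simp
      then show ?thesis
        using funpow_image_antimono[OF assms(3), of N "Suc N"] by auto
    qed
    then show "x \<in> omega_limit f B"
      by (simp add: omega_limit_def)
  next
    show "x \<in> (\<Inter>N\<in>{1..}. (f ^^ N) ` B)" if "x \<in> omega_limit f B" for x
      using that unfolding omega_limit_def by (intro INT_I) (rule INT_D, assumption, rule UNIV_I)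
  qed
  finally show ?thesis .
qed

section \<open>The implicit Euler scheme as an iteration\<close>

text \<open>The value is meaningful at those \<open>x\<close> for which the implicit equation has exactly one solution.\<close>

definition implicit_step :: "('a::real_normed_vector \<Rightarrow> 'a) \<Rightarrow> real \<Rightarrow> 'a \<Rightarrow> 'a"
  where "implicit_step F \<epsilon> x = (THE z. z = x + \<epsilon> *\<^sub>R F z)"

text \<open>If each implicit equation with datum in \<open>B\<close> has one solution in the whole space and that solution
  lies again in \<open>B\<close>, then solving the scheme is iterating the one-step map: no step can leave \<open>B\<close>, so
  the next step is again determined.\<close>

lemma scheme_solution_iff_funpow:
  assumes ex1: "\<And>x. x \<in> B \<Longrightarrow> \<exists>!z. z = x + \<epsilon> *\<^sub>R F z"
    and inB: "\<And>x z. x \<in> B \<Longrightarrow> z = x + \<epsilon> *\<^sub>R F z \<Longrightarrow> z \<in> B"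
    and y: "y \<in> B"
  shows "scheme_solution F \<epsilon> y u \<longleftrightarrow> (\<forall>n. u n = (implicit_step F \<epsilon> ^^ n) y)"
    and "(implicit_step F \<epsilon> ^^ n) y \<in> B"
proof -
  let ?f = "implicit_step F \<epsilon>"
  have step: "z = x + \<epsilon> *\<^sub>R F z \<longleftrightarrow> z = ?f x" if "x \<in> B" for x z
    using theI'[OF ex1[OF that]] ex1[OF that] unfolding implicit_step_def by blast
  have fB: "?f x \<in> B" if "x \<in> B" for x
    using step[OF that] inB[OF that] by blast
  show pow: "(?f ^^ n) y \<in> B" for n
    using y fB by (induction n) auto
  have *: "scheme_solution F \<epsilon> y u \<longleftrightarrow> u 0 = y \<and> (\<forall>n. u (Suc n) = u n + \<epsilon> *\<^sub>R F (u (Suc n)))"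
  proof -
    have "(\<forall>n\<ge>1. P n) \<longleftrightarrow> (\<forall>n. P (Suc n))" for P :: "nat \<Rightarrow> bool"
      using Suc_le_D by auto
    from this[of "\<lambda>n. u n = u (n - 1) + \<epsilon> *\<^sub>R F (u n)"] show ?thesis
      by (simp add: scheme_solution_def)
  qed
  show "scheme_solution F \<epsilon> y u \<longleftrightarrow> (\<forall>n. u n = (?f ^^ n) y)"
  proof
    assume u: "scheme_solution F \<epsilon> y u"
    have "u n = (?f ^^ n) y" for n
    proof (induction n)
      case (Suc n)
      have "u (Suc n) = u n + \<epsilon> *\<^sub>R F (u (Suc n))"
        using u unfolding * by blast
      then show ?case
        using Suc.IH pow[of n] step by simp
    qed (use u scheme_solution_def in auto)
    then show "\<forall>n. u n = (?f ^^ n) y" ..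
  next
    assume u: "\<forall>n. u n = (?f ^^ n) y"
    have "u (Suc n) = u n + \<epsilon> *\<^sub>R F (u (Suc n))" for n
      using u step[OF pow, of "u (Suc n)" n] by simp
    then show "scheme_solution F \<epsilon> y u"
      using u * by simp
  qed
qed

text \<open>The bounds are required on the larger ball of radius \<open>R + 1\<close>: if \<open>norm x \<le> R\<close>, then
  \<open>z \<mapsto> x + \<epsilon> *\<^sub>R F z\<close> sends that ball to points at distance at most \<open>\<epsilon> * M \<le> 1\<close> from \<open>x\<close>, so it is
  a contraction of the ball into itself and has a fixed point. The a priori estimate puts every
  solution, wherever it was sought, into the ball of radius \<open>R\<close>, where the Lipschitz bound yields
  both uniqueness and Lipschitz dependence on \<open>x\<close>.\<close>

theorem implicit_scheme_attractor:
  fixes F :: "'a::{real_normed_vector, heine_borel} \<Rightarrow> 'a"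
  assumes "0 \<le> R" and \<epsilon>: "0 < \<epsilon>" and \<epsilon>L: "\<epsilon> * L < 1" and \<epsilon>M: "\<epsilon> * M \<le> 1" and "0 \<le> L"
    and bound: "\<And>z. norm z \<le> R + 1 \<Longrightarrow> norm (F z) \<le> M"
    and lipschitz: "\<And>z w. norm z \<le> R + 1 \<Longrightarrow> norm w \<le> R + 1 \<Longrightarrow> norm (F z - F w) \<le> L * norm (z - w)"
    and apriori: "\<And>x z. norm x \<le> R \<Longrightarrow> z = x + \<epsilon> *\<^sub>R F z \<Longrightarrow> norm z \<le> R"
  defines "B \<equiv> cball (0 :: 'a) R" and "S \<equiv> solution_map F \<epsilon>"
  shows "\<forall>y\<in>B. (\<exists>!u. scheme_solution F \<epsilon> y u) \<and> (\<forall>u. scheme_solution F \<epsilon> y u \<longrightarrow> (\<forall>n. u n \<in> B))"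
    and "\<exists>!A. is_attractor S B A"
    and "is_attractor S B (\<Inter>N\<in>{1..}. closure (\<Union>n\<in>{N..}. S n ` B))"
proof -
  let ?f = "implicit_step F \<epsilon>"
  have inB: "z \<in> B" if "x \<in> B" "z = x + \<epsilon> *\<^sub>R F z" for x z
    using that apriori[of x z] by (simp add: B_def)
  have stab: "norm (z - w) \<le> norm (x - y) / (1 - \<epsilon> * L)"
    if "x \<in> B" "y \<in> B" "z = x + \<epsilon> *\<^sub>R F z" "w = y + \<epsilon> *\<^sub>R F w" for x y z w
  proof -
    have "norm (z - w) = norm ((x - y) + \<epsilon> *\<^sub>R (F z - F w))"
      by (metis that(3,4) add_diff_add scaleR_right_diff_distrib)
    also have "\<dots> \<le> norm (x - y) + \<epsilon> * norm (F z - F w)"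
      using norm_triangle_ineq[of "x - y" "\<epsilon> *\<^sub>R (F z - F w)"] \<epsilon> by simp
    also have "\<dots> \<le> norm (x - y) + \<epsilon> * (L * norm (z - w))"
      using inB[OF that(1,3)] inB[OF that(2,4)] \<epsilon>
      by (intro add_left_mono mult_left_mono lipschitz) (auto simp: B_def)
    finally show ?thesis
      using \<epsilon>L by (simp add: field_simps)
  qed
  have ex1: "\<exists>!z. z = x + \<epsilon> *\<^sub>R F z" if x: "x \<in> B" for x
  proof -
    have "\<exists>!z. z \<in> cball 0 (R + 1) \<and> x + \<epsilon> *\<^sub>R F z = z"
    proof (rule Banach_fix[where c = "\<epsilon> * L"])
      show "(\<lambda>z. x + \<epsilon> *\<^sub>R F z) ` cball 0 (R + 1) \<subseteq> cball 0 (R + 1)"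
      proof clarsimp
        fix z :: 'a assume "norm z \<le> R + 1"
        have "norm (x + \<epsilon> *\<^sub>R F z) \<le> norm x + \<epsilon> * norm (F z)"
          using norm_triangle_ineq[of x "\<epsilon> *\<^sub>R F z"] \<epsilon> by simp
        also have "\<dots> \<le> R + \<epsilon> * M"
          using x bound[OF \<open>norm z \<le> R + 1\<close>] \<epsilon> by (intro add_mono mult_left_mono) (auto simp: B_def)
        finally show "norm (x + \<epsilon> *\<^sub>R F z) \<le> R + 1"
          using \<epsilon>M by simp
      qed
      show "dist (x + \<epsilon> *\<^sub>R F z) (x + \<epsilon> *\<^sub>R F w) \<le> \<epsilon> * L * dist z w"
        if "z \<in> cball 0 (R + 1)" "w \<in> cball 0 (R + 1)" for z w
        using that lipschitz[of z w] \<epsilon>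
        by (simp add: dist_norm flip: scaleR_right_diff_distrib)
    qed (use assms in \<open>auto simp: complete_eq_closed\<close>)
    then obtain z where "z = x + \<epsilon> *\<^sub>R F z"
      by metis
    moreover have "w = z" if "w = x + \<epsilon> *\<^sub>R F w" for w
      using stab[OF x x that \<open>z = _\<close>] by simp
    ultimately show ?thesis
      by blast
  qed
  have iff: "scheme_solution F \<epsilon> y u \<longleftrightarrow> (\<forall>n. u n = (?f ^^ n) y)" if "y \<in> B" for y u
    using ex1 inB that by (rule scheme_solution_iff_funpow(1))
  have iter: "(?f ^^ n) y \<in> B" if "y \<in> B" for y n
    using ex1 inB that by (rule scheme_solution_iff_funpow(2))
  have step: "?f x = x + \<epsilon> *\<^sub>R F (?f x)" if "x \<in> B" for x
    using theI'[OF ex1[OF that]] unfolding implicit_step_def .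
  have S: "S n y = (?f ^^ n) y" if "y \<in> B" for n y
  proof -
    have "(THE u. scheme_solution F \<epsilon> y u) = (\<lambda>n. (?f ^^ n) y)"
      using iff[OF that] by (intro the_equality) auto
    then show ?thesis
      by (simp add: S_def solution_map_def)
  qed
  have "(1 / (1 - \<epsilon> * L))-lipschitz_on B ?f"
    using stab step \<epsilon>L by (auto intro!: lipschitz_onI simp: dist_norm)
  then have f: "compact B" "continuous_on B ?f" "?f ` B \<subseteq> B"
    using inB step lipschitz_on_continuous_on by (auto simp: B_def)
  show "\<forall>y\<in>B. (\<exists>!u. scheme_solution F \<epsilon> y u) \<and> (\<forall>u. scheme_solution F \<epsilon> y u \<longrightarrow> (\<forall>n. u n \<in> B))"
  proof (intro ballI conjI allI impI)
    fix y assume y: "y \<in> B"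
    show "\<exists>!u. scheme_solution F \<epsilon> y u"
      using iff[OF y] by (intro ex1I[of _ "\<lambda>n. (?f ^^ n) y"]) auto
    show "u n \<in> B" if "scheme_solution F \<epsilon> y u" for u n
      using that iff[OF y] iter[OF y] by auto
  qed
  have att: "is_attractor S B (omega_limit ?f B)"
    using is_attractor_omega_limit[OF f S] .
  then show "is_attractor S B (\<Inter>N\<in>{1..}. closure (\<Union>n\<in>{N..}. S n ` B))"
    using omega_limit_eq_INT_closure[OF f S] by simp
  show "\<exists>!A. is_attractor S B A"
    using att is_attractor_subset by blast
qed

section \<open>Square-summable sequences, finite vectors and the power nonlinearity\<close>

lemma norm_vector_mult:
  fixes z :: "complex ^ 'n::finite"
  shows "norm (c *s z) = norm c * norm z"
  by (simp add: norm_vec_def norm_mult L2_set_right_distrib)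

lemma norm_reindex:
  fixes z :: "complex ^ 'n::finite"
  assumes "bij s"
  shows "norm (\<chi> i. z $ s i) = norm z"
  unfolding norm_vec_def L2_set_def
  using sum.reindex_bij_betw[OF assms, of "\<lambda>i. (norm (z $ i))\<^sup>2"] by simp

text \<open>Young's inequality for the exponents \<open>(p + 2) / (p + 1)\<close> and \<open>p + 2\<close>, with the factors rescaled so
  that \<open>b powr (p + 2)\<close> carries the coefficient \<open>k\<close>; the constant that remains in front of the power
  of \<open>a\<close> is the one in \<^const>\<open>c_one\<close>.\<close>

lemma Young_weighted:
  fixes a b k p :: real
  assumes "0 \<le> a" "0 \<le> b" "0 < k" "0 < p"
  shows "a * b \<le> k * b powr (p + 2) +
     (p + 1) / (p + 2) * (1 / (k * (p + 2)) powr (1 / (p + 1))) * a powr ((p + 2) / (p + 1))"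
proof -
  define q where "q = (p + 2) / (p + 1)"
  define K where "K = k * (p + 2)"
  \<comment> \<open>The rescaling by \<open>t\<close> gives the coefficient, because \<open>t powr (p + 2) = k * (p + 2)\<close>.\<close>
  define t where "t = K powr (1 / (p + 2))"
  have K: "K > 0" and t: "t > 0"
    using assms by (auto simp: K_def t_def)
  have "(a / t) * (t * b) \<le> (a / t) powr q / q + (t * b) powr (p + 2) / (p + 2)"
    using assms t by (intro Youngs_inequality) (auto simp: q_def field_simps)
  moreover have "(t * b) powr (p + 2) / (p + 2) = k * b powr (p + 2)"
    using assms K t by (simp add: powr_mult t_def powr_powr) (simp add: K_def)
  moreover have "(a / t) powr q = a powr q / K powr (1 / (p + 1))"
    using assms K t by (simp add: powr_divide t_def powr_powr q_def)
  moreover have "x / q = (p + 1) / (p + 2) * x" for x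
    by (simp add: q_def)
  ultimately have "a * b \<le> (p + 1) / (p + 2) * (a powr q / K powr (1 / (p + 1))) + k * b powr (p + 2)"
    using t by simp
  then show ?thesis
    by (simp add: q_def K_def)
qed

text \<open>Each term \<open>norm (u j) powr q\<close> is bounded by the sum of the series, so the surplus
  factor \<open>norm (u j) powr (2 - q)\<close> is bounded uniformly in \<open>j\<close>.\<close>

lemma ell_mono_2:
  assumes "0 < q" "q \<le> 2" "u \<in> ell q"
  shows "u \<in> ell 2"
proof -
  define T where "T = (\<Sum>\<^sub>\<infinity>j. norm (u j) powr q)"
  have sm: "(\<lambda>j. norm (u j) powr q) summable_on UNIV"
    using assms by (simp add: ell_def)
  have le: "norm (u j) powr q \<le> T" for j
    using finite_sum_le_infsum[OF sm, of "{j}"] by (simp add: T_def)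
  have "norm (u j) powr 2 \<le> T powr ((2 - q) / q) * norm (u j) powr q" for j
  proof -
    \<comment> \<open>The powers match because \<open>q * ((2 - q) / q) + q = 2\<close>.\<close>
    have "norm (u j) powr 2 = (norm (u j) powr q) powr ((2 - q) / q) * norm (u j) powr q"
      using assms by (simp add: powr_powr flip: powr_add)
    also have "\<dots> \<le> T powr ((2 - q) / q) * norm (u j) powr q"
      using assms le by (intro mult_right_mono powr_mono2) auto
    finally show ?thesis .
  qed
  then show ?thesis
    unfolding ell_def mem_Collect_eq
    by (intro summable_on_comparison_test[OF summable_on_cmult_right[OF sm]]) auto
qed

lemma norm_restrict_le:
  fixes ix :: "'n::finite \<Rightarrow> int"
  assumes "u \<in> ell 2" "inj ix"
  shows "norm (\<chi> i. u (ix i)) \<le> ell_norm 2 u"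
proof -
  have "(\<Sum>i\<in>UNIV. (norm (u (ix i)))\<^sup>2) = (\<Sum>j\<in>range ix. norm (u j) powr 2)"
    using assms(2) by (simp add: sum.reindex)
  also have "\<dots> \<le> (\<Sum>\<^sub>\<infinity>j. norm (u j) powr 2)"
    using assms(1) by (intro finite_sum_le_infsum) (auto simp: ell_def)
  finally have "sqrt (\<Sum>i\<in>UNIV. (norm (u (ix i)))\<^sup>2) \<le> sqrt (\<Sum>\<^sub>\<infinity>j. norm (u j) powr 2)"
    by simp
  then show ?thesis
    by (simp add: norm_vec_def L2_set_def ell_norm_def powr_half_sqrt infsum_nonneg)
qed

text \<open>Extension by zero embeds \<open>complex ^ 'n\<close> isometrically into the square-summable sequences, which makes
  the Lipschitz constant of the nonlinearity on sequences available for finite vectors.\<close>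

lemma finite_support_ell2:
  fixes ix :: "'n::finite \<Rightarrow> int"
  assumes "inj ix" "\<And>j. j \<notin> range ix \<Longrightarrow> u j = 0"
  shows "u \<in> ell 2" "ell_norm 2 u = norm (\<chi> i. u (ix i))"
proof -
  have "(\<lambda>j. norm (u j) powr 2) summable_on UNIV \<longleftrightarrow> (\<lambda>j. norm (u j) powr 2) summable_on range ix"
    using assms(2) by (intro summable_on_cong_neutral) auto
  then show "u \<in> ell 2"
    by (simp add: ell_def)
  have "(\<Sum>\<^sub>\<infinity>j. norm (u j) powr 2) = (\<Sum>\<^sub>\<infinity>j\<in>range ix. norm (u j) powr 2)"
    using assms(2) by (intro infsum_cong_neutral) auto
  also have "\<dots> = (\<Sum>i\<in>UNIV. (norm (u (ix i)))\<^sup>2)"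
    using assms(1) by (simp add: sum.reindex)
  finally show "ell_norm 2 u = norm (\<chi> i. u (ix i))"
    by (simp add: norm_vec_def L2_set_def ell_norm_def powr_half_sqrt sum_nonneg)
qed

definition pow_vec :: "real \<Rightarrow> complex ^ 'n::finite \<Rightarrow> complex ^ 'n"
  where "pow_vec p z = (\<chi> i. pow_nonlin p (z $ i))"

lemma norm_pow_vec_diff_le:
  fixes z w :: "complex ^ 'n::finite" and ix :: "'n \<Rightarrow> int"
  assumes "pow_Lipschitz_const p C" "inj ix" "0 < r" "norm z \<le> r" "norm w \<le> r"
  shows "norm (pow_vec p z - pow_vec p w) \<le> C * r powr p * norm (z - w)"
proof -
  define e :: "complex ^ 'n \<Rightarrow> int \<Rightarrow> complex"
    where "e z = (\<lambda>j. if j \<in> range ix then z $ inv ix j else 0)" for z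
  have e: "e z (ix i) = z $ i" for z i
    using assms(2) by (simp add: e_def)
  have e0: "e z j = 0" if "j \<notin> range ix" for z j
    using that by (simp add: e_def)
  have ball: "e z \<in> ell2_ball r" if "norm z \<le> r" for z
    using finite_support_ell2[OF assms(2) e0] that by (simp add: ell2_ball_def e)
  have "ell_norm 2 (\<lambda>j. pow_nonlin p (e z j) - pow_nonlin p (e w j))
      \<le> C * r powr p * ell_norm 2 (\<lambda>j. e z j - e w j)"
    using assms ball unfolding pow_Lipschitz_const_def by blast
  moreover have "ell_norm 2 (\<lambda>j. pow_nonlin p (e z j) - pow_nonlin p (e w j)) = norm (pow_vec p z - pow_vec p w)"
    using finite_support_ell2(2)[OF assms(2), of "\<lambda>j. pow_nonlin p (e z j) - pow_nonlin p (e w j)"] e0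
    by (simp add: e pow_vec_def minus_vec_def)
  moreover have "ell_norm 2 (\<lambda>j. e z j - e w j) = norm (z - w)"
    using finite_support_ell2(2)[OF assms(2), of "\<lambda>j. e z j - e w j"] e0
    by (simp add: e minus_vec_def)
  ultimately show ?thesis
    by simp
qed

lemma norm_pow_vec_le:
  assumes "0 < p"
  shows "norm (pow_vec p z) \<le> norm z powr (p + 1)"
proof -
  have "norm (pow_vec p z) \<le> L2_set (\<lambda>i. norm z powr p * norm (z $ i)) UNIV"
    unfolding norm_vec_def[of "pow_vec p z"] using assms
    by (intro L2_set_mono) (auto simp: pow_vec_def pow_nonlin_def norm_mult intro!: mult_right_mono powr_mono2 Finite_Cartesian_Product.norm_nth_le)
  also have "\<dots> = norm z powr p * norm z"
    by (simp add: norm_vec_def L2_set_right_distrib)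
  finally show ?thesis
    by (cases "z = 0") (simp_all add: powr_add)
qed

section \<open>The periodic matrix\<close>

text \<open>The cyclic successor of an index, through which the periodic matrix is \<open>2 - T - T\<inverse>\<close> for a
  permutation operator \<open>T\<close>.\<close>

definition shift :: "nat \<Rightarrow> ('n::finite \<Rightarrow> int) \<Rightarrow> 'n \<Rightarrow> 'n"
  where "shift m ix i = inv ix (wrap m (ix i + 1))"

text \<open>Both the norm bound and the self-adjointness of the matrix are read off this form, since \<open>T\<close> and its
  inverse are isometries adjoint to each other.\<close>

lemma periodic_Lambda_shift:
  fixes ix :: "'n::finite \<Rightarrow> int"
  assumes "bij_betw ix UNIV {- int m..int m}"
  shows "bij (shift m ix)"
    and "periodic_Lambda m ix z = 2 *\<^sub>R z - (\<chi> i. z $ shift m ix i) - (\<chi> i. z $ inv (shift m ix) i)"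
proof -
  let ?T = "\<lambda>i. inv ix (wrap m (ix i - 1))"
  have inj: "inj ix" and rng: "range ix = {- int m..int m}"
    using assms by (auto simp: bij_betw_def)
  have mem: "- int m \<le> ix i" "ix i \<le> int m" for i
    using rng by auto
  have up: "ix (shift m ix i) = wrap m (ix i + 1)" for i
    unfolding shift_def by (rule f_inv_into_f) (use mem[of i] in \<open>auto simp: wrap_def rng\<close>)
  have dn: "ix (?T i) = wrap m (ix i - 1)" for i
    by (rule f_inv_into_f) (use mem[of i] in \<open>auto simp: wrap_def rng\<close>)
  have ud: "shift m ix (?T i) = i" for i
    by (rule injD[OF inj], unfold up dn) (use mem[of i] in \<open>auto simp: wrap_def\<close>)
  have du: "?T (shift m ix i) = i" for i
    by (rule injD[OF inj], subst dn, subst up) (use mem[of i] in \<open>auto simp: wrap_def\<close>)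
  show b: "bij (shift m ix)"
    using ud du by (intro o_bij[of ?T]) (auto simp: fun_eq_iff)
  have "inv (shift m ix) = ?T"
    using ud du by (intro inv_equality) auto
  then show "periodic_Lambda m ix z = 2 *\<^sub>R z - (\<chi> i. z $ shift m ix i) - (\<chi> i. z $ inv (shift m ix) i)"
    using inj by (simp add: vec_eq_iff periodic_Lambda_def coord_def shift_def scaleR_conv_of_real)
qed

lemma periodic_Lambda_diff: "periodic_Lambda m ix z - periodic_Lambda m ix w = periodic_Lambda m ix (z - w)"
  by (simp add: vec_eq_iff periodic_Lambda_def coord_def algebra_simps)

lemma norm_periodic_Lambda_le:
  assumes "bij_betw ix UNIV {- int m..int m}"
  shows "norm (periodic_Lambda m ix z) \<le> 4 * norm z"
proof -
  note b = periodic_Lambda_shift(1)[OF assms]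
  show ?thesis
    unfolding periodic_Lambda_shift(2)[OF assms]
    using norm_triangle_ineq4[of "2 *\<^sub>R z - (\<chi> i. z $ shift m ix i)" "\<chi> i. z $ inv (shift m ix) i"]
      norm_triangle_ineq4[of "2 *\<^sub>R z" "\<chi> i. z $ shift m ix i"]
      norm_reindex[OF b, of z] norm_reindex[OF bij_imp_bij_inv[OF b], of z]
    by simp
qed

text \<open>The real inner product is the real part of the Hermitian one, so a complex coefficient contributes
  its imaginary part through \<open>\<i> *s z\<close>. In the energy estimate these contributions vanish.\<close>

lemma vector_mult_inner: "((c *s z) \<bullet> w) = Re c * (z \<bullet> w) + Im c * ((\<i> *s z) \<bullet> w)"
  for z w :: "complex ^ 'n::finite"
  by (simp add: inner_vec_def inner_complex_def sum_distrib_left flip: sum.distrib)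
     (simp add: algebra_simps)

lemma ii_mult_inner_self: "((\<i> *s z) \<bullet> z) = 0"
  for z :: "complex ^ 'n::finite"
  by (simp add: inner_vec_def inner_complex_def algebra_simps)

lemma inner_reindex_inv:
  fixes z w :: "complex ^ 'n::finite"
  assumes "bij s"
  shows "(\<chi> i. z $ inv s i) \<bullet> w = z \<bullet> (\<chi> i. w $ s i)"
  unfolding inner_vec_def
  using sum.reindex_bij_betw[OF assms, of "\<lambda>i. z $ inv s i \<bullet> w $ i"] assms
  by (simp add: bij_is_inj)

text \<open>The matrix is self-adjoint, so its Hermitian form is real. Concretely, the terms with \<open>T\<close> and
  \<open>T\<inverse>\<close> have conjugate values and their imaginary parts cancel.\<close>

lemma ii_periodic_Lambda_inner_self:
  assumes "bij_betw ix UNIV {- int m..int m}"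
  shows "(\<i> *s periodic_Lambda m ix z) \<bullet> z = 0"
proof -
  let ?s = "shift m ix"
  have "(\<i> *s periodic_Lambda m ix z) = 2 *\<^sub>R (\<i> *s z) - (\<i> *s (\<chi> i. z $ ?s i)) - (\<chi> i. (\<i> *s z) $ inv ?s i)"
    unfolding periodic_Lambda_shift(2)[OF assms]
    by (simp add: vec_eq_iff algebra_simps scaleR_conv_of_real)
  then have "(\<i> *s periodic_Lambda m ix z) \<bullet> z =
      - ((\<i> *s (\<chi> i. z $ ?s i)) \<bullet> z) - (\<i> *s z) \<bullet> (\<chi> i. z $ ?s i)"
    using inner_reindex_inv[OF periodic_Lambda_shift(1)[OF assms], of "\<i> *s z" z]
    by (simp add: inner_diff_left ii_mult_inner_self)
  also have "\<dots> = 0"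
    by (simp add: inner_vec_def inner_complex_def algebra_simps flip: sum_negf sum_subtractf)
  finally show ?thesis .
qed

section \<open>Boundedness, Lipschitz continuity and dissipativity of the field\<close>

lemma scheme_field_pow_vec: "scheme_field lam \<mu> \<gamma> \<beta> k \<nu> p g m ix z =
    Complex lam \<mu> *s periodic_Lambda m ix z - Complex \<gamma> \<beta> *s z - Complex k \<nu> *s pow_vec p z + (\<chi> i. g (ix i))"
  by (simp add: scheme_field_def pow_vec_def)

lemma norm_Complex_le: "norm (Complex a b) \<le> \<bar>a\<bar> + \<bar>b\<bar>"
  using cmod_le[of "Complex a b"] by simp

lemma norm_linear_part_le:
  assumes "bij_betw ix UNIV {- int m..int m}" "0 \<le> lam" "0 \<le> \<gamma>"
  shows "norm (Complex lam \<mu> *s periodic_Lambda m ix z - Complex \<gamma> \<beta> *s z)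
     \<le> (4 * lam + 4 * \<bar>\<mu>\<bar> + \<gamma> + \<bar>\<beta>\<bar>) * norm z"
proof -
  have "norm (Complex lam \<mu> *s periodic_Lambda m ix z) \<le> (lam + \<bar>\<mu>\<bar>) * (4 * norm z)"
    unfolding norm_vector_mult using assms norm_Complex_le[of lam \<mu>] norm_periodic_Lambda_le[OF assms(1)]
    by (intro mult_mono) auto
  moreover have "norm (Complex \<gamma> \<beta> *s z) \<le> (\<gamma> + \<bar>\<beta>\<bar>) * norm z"
    unfolding norm_vector_mult using assms norm_Complex_le[of \<gamma> \<beta>]
    by (intro mult_right_mono) auto
  ultimately show ?thesis
    using norm_triangle_ineq4[of "Complex lam \<mu> *s periodic_Lambda m ix z" "Complex \<gamma> \<beta> *s z"]
    by (simp add: algebra_simps)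
qed

lemma norm_scheme_field_le:
  assumes ix: "bij_betw ix UNIV {- int m..int m}" and "0 < lam" "0 < \<gamma>" "0 < k" "0 < p"
    and g: "g \<in> ell 2" and z: "norm z \<le> r"
  shows "norm (scheme_field lam \<mu> \<gamma> \<beta> k \<nu> p g m ix z) \<le> M_bound lam \<mu> \<gamma> \<beta> k \<nu> p g r"
proof -
  let ?A = "Complex lam \<mu> *s periodic_Lambda m ix z - Complex \<gamma> \<beta> *s z"
  let ?N = "Complex k \<nu> *s pow_vec p z" and ?G = "\<chi> i. g (ix i)"
  have "norm ?A \<le> (4 * lam + 4 * \<bar>\<mu>\<bar> + \<gamma> + \<bar>\<beta>\<bar>) * r"
    using assms by (intro order_trans[OF norm_linear_part_le[OF ix] mult_left_mono]) auto
  moreover have "norm ?N \<le> (k + \<bar>\<nu>\<bar>) * r powr (p + 1)"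
  proof -
    have "norm (pow_vec p z) \<le> r powr (p + 1)"
      using assms by (intro order_trans[OF norm_pow_vec_le powr_mono2]) auto
    then show ?thesis
      unfolding norm_vector_mult using assms norm_Complex_le[of k \<nu>] by (intro mult_mono) auto
  qed
  moreover have "norm ?G \<le> ell_norm 2 g"
    by (rule norm_restrict_le[OF g bij_betw_imp_inj_on[OF ix]])
  moreover have "norm (?A - ?N + ?G) \<le> norm ?A + norm ?N + norm ?G"
    by (meson add_right_mono norm_triangle_ineq norm_triangle_ineq4 order_trans)
  ultimately show ?thesis
    unfolding scheme_field_pow_vec M_bound_def by linarith
qed

lemma scheme_field_lipschitz:
  fixes ix :: "'n::finite \<Rightarrow> int"
  assumes ix: "bij_betw ix UNIV {- int m..int m}" and "0 < lam" "0 < \<gamma>" "0 < k"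
    and C: "pow_Lipschitz_const p C" and "0 < r" "norm z \<le> r" "norm w \<le> r"
  shows "norm (scheme_field lam \<mu> \<gamma> \<beta> k \<nu> p g m ix z - scheme_field lam \<mu> \<gamma> \<beta> k \<nu> p g m ix w)
    \<le> L_bound lam \<mu> \<gamma> \<beta> k \<nu> p C r * norm (z - w)"
proof -
  let ?A = "Complex lam \<mu> *s periodic_Lambda m ix (z - w) - Complex \<gamma> \<beta> *s (z - w)"
  let ?N = "Complex k \<nu> *s (pow_vec p z - pow_vec p w)"
  have "norm ?N \<le> (k + \<bar>\<nu>\<bar>) * (C * r powr p * norm (z - w))"
    unfolding norm_vector_mult using assms norm_Complex_le[of k \<nu>]
      norm_pow_vec_diff_le[OF C bij_betw_imp_inj_on[OF ix]] by (intro mult_mono) auto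
  moreover have "norm ?A \<le> (4 * lam + 4 * \<bar>\<mu>\<bar> + \<gamma> + \<bar>\<beta>\<bar>) * norm (z - w)"
    using assms by (intro norm_linear_part_le[OF ix]) auto
  moreover have "norm (?A - ?N) \<le> norm ?A + norm ?N"
    by (rule norm_triangle_ineq4)
  ultimately have "norm (?A - ?N)
      \<le> (4 * lam + 4 * \<bar>\<mu>\<bar> + \<gamma> + \<bar>\<beta>\<bar>) * norm (z - w) + (k + \<bar>\<nu>\<bar>) * (C * r powr p * norm (z - w))"
    by linarith
  also have "?A - ?N = scheme_field lam \<mu> \<gamma> \<beta> k \<nu> p g m ix z - scheme_field lam \<mu> \<gamma> \<beta> k \<nu> p g m ix w"
    unfolding scheme_field_pow_vec periodic_Lambda_diff[symmetric]
    by (simp add: vec_eq_iff algebra_simps)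
  finally show ?thesis
    by (simp add: L_bound_def algebra_simps)
qed

text \<open>The damping of degree \<open>p + 2\<close> absorbs the forcing coordinate by coordinate, which is why the norm
  of \<open>g\<close> with the conjugate exponent appears and the bound does not depend on the dimension.\<close>

lemma forcing_le_c_one:
  fixes z :: "complex ^ 'n::finite" and ix :: "'n \<Rightarrow> int"
  assumes "inj ix" "0 < k" "0 < p" "g \<in> ell ((p + 2) / (p + 1))"
  shows "(\<chi> i. g (ix i)) \<bullet> z \<le> k * (pow_vec p z \<bullet> z) + c_one k p g"
proof -
  let ?q = "(p + 2) / (p + 1)"
  let ?c = "(p + 1) / (p + 2) * (1 / (k * (p + 2)) powr (1 / (p + 1)))"
  have sm: "(\<lambda>j. norm (g j) powr ?q) summable_on UNIV"
    using assms by (simp add: ell_def)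
  have "g (ix i) \<bullet> z $ i \<le> k * (pow_vec p z $ i \<bullet> z $ i) + ?c * norm (g (ix i)) powr ?q" for i
  proof -
    have "pow_vec p z $ i \<bullet> z $ i = norm (z $ i) powr p * (norm (z $ i))\<^sup>2"
      by (simp add: pow_vec_def pow_nonlin_def scaleR_conv_of_real[symmetric] power2_norm_eq_inner)
    also have "\<dots> = norm (z $ i) powr (p + 2)"
      by (cases "z $ i = 0") (simp_all add: powr_add)
    finally show ?thesis
      using Young_weighted[of "norm (g (ix i))" "norm (z $ i)" k p] assms norm_cauchy_schwarz[of "g (ix i)" "z $ i"]
      by simp
  qed
  then have "(\<chi> i. g (ix i)) \<bullet> z \<le> (\<Sum>i\<in>UNIV. k * (pow_vec p z $ i \<bullet> z $ i) + ?c * norm (g (ix i)) powr ?q)"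
    unfolding inner_vec_def by (intro sum_mono) simp
  also have "\<dots> = k * (pow_vec p z \<bullet> z) + ?c * (\<Sum>i\<in>UNIV. norm (g (ix i)) powr ?q)"
    by (simp only: sum.distrib sum_distrib_left inner_vec_def)
  also have "?c * (\<Sum>i\<in>UNIV. norm (g (ix i)) powr ?q) \<le> ?c * ell_norm ?q g powr ?q"
  proof (rule mult_left_mono)
    have "(\<Sum>i\<in>UNIV. norm (g (ix i)) powr ?q) = (\<Sum>j\<in>range ix. norm (g j) powr ?q)"
      using assms by (simp add: sum.reindex)
    also have "\<dots> \<le> (\<Sum>\<^sub>\<infinity>j. norm (g j) powr ?q)"
      by (intro finite_sum_le_infsum[OF sm]) auto
    also have "\<dots> = ell_norm ?q g powr ?q"
      using assms by (simp add: ell_norm_def powr_powr infsum_nonneg)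
    finally show "(\<Sum>i\<in>UNIV. norm (g (ix i)) powr ?q) \<le> ell_norm ?q g powr ?q" .
  qed (use assms in simp)
  finally show ?thesis
    by (simp add: c_one_def)
qed

text \<open>The energy estimate. The parameters \<open>\<mu>\<close>, \<open>\<beta>\<close> and \<open>\<nu>\<close> multiply the imaginary unit times a real
  Hermitian form and drop out. The matrix enters with the sign that feeds energy in, at a rate of at most \<open>4 * lam\<close>, so
  the linear damping must exceed this rate to be effective.\<close>

lemma scheme_field_dissipative:
  fixes z :: "complex ^ 'n::finite" and ix :: "'n \<Rightarrow> int"
  assumes ix: "bij_betw ix UNIV {- int m..int m}" and "0 < lam" "0 < k" "0 < p"
    and "g \<in> ell ((p + 2) / (p + 1))"
  shows "scheme_field lam \<mu> \<gamma> \<beta> k \<nu> p g m ix z \<bullet> z \<le> c_one k p g - (\<gamma> - 4 * lam) * (norm z)\<^sup>2"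
proof -
  have "(\<i> *s pow_vec p z) \<bullet> z = 0"
    by (simp add: inner_vec_def inner_complex_def pow_vec_def pow_nonlin_def algebra_simps)
  then have eq: "scheme_field lam \<mu> \<gamma> \<beta> k \<nu> p g m ix z \<bullet> z =
      lam * (periodic_Lambda m ix z \<bullet> z) - \<gamma> * (norm z)\<^sup>2 - k * (pow_vec p z \<bullet> z) + (\<chi> i. g (ix i)) \<bullet> z"
    unfolding scheme_field_pow_vec inner_add_left inner_diff_left
      vector_mult_inner[of "Complex lam \<mu>"] vector_mult_inner[of "Complex \<gamma> \<beta>"] vector_mult_inner[of "Complex k \<nu>"]
    by (simp add: ii_mult_inner_self ii_periodic_Lambda_inner_self[OF ix] power2_norm_eq_inner)
  have "periodic_Lambda m ix z \<bullet> z \<le> norm (periodic_Lambda m ix z) * norm z"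
    by (rule norm_cauchy_schwarz)
  also have "\<dots> \<le> 4 * (norm z)\<^sup>2"
    using norm_periodic_Lambda_le[OF ix, of z] mult_right_mono[of _ _ "norm z"]
    by (force simp: power2_eq_square)
  finally have "lam * (periodic_Lambda m ix z \<bullet> z) \<le> lam * (4 * (norm z)\<^sup>2)"
    using assms by (intro mult_left_mono) auto
  moreover have "(\<chi> i. g (ix i)) \<bullet> z \<le> k * (pow_vec p z \<bullet> z) + c_one k p g"
    using assms by (intro forcing_le_c_one bij_betw_imp_inj_on[OF ix])
  ultimately show ?thesis
    unfolding eq by (simp add: left_diff_distrib)
qed

text \<open>An implicit step inherits the energy decay of the field for every step size: pairing
  \<open>z = x + \<epsilon> *\<^sub>R F z\<close> with \<open>z\<close> evaluates the dissipation at the new point. The estimate holds for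
  solutions of any size and thereby rules out solutions outside the ball.\<close>

lemma dissipative_step_in_ball:
  fixes x z :: "'a::real_inner"
  assumes "0 < \<epsilon>" "0 < \<delta>" "c \<le> \<delta> * R\<^sup>2" "0 \<le> R"
    and diss: "F z \<bullet> z \<le> c - \<delta> * (norm z)\<^sup>2"
    and x: "norm x \<le> R" and z: "z = x + \<epsilon> *\<^sub>R F z"
  shows "norm z \<le> R"
proof -
  have "(norm z)\<^sup>2 = (x + \<epsilon> *\<^sub>R F z) \<bullet> z"
    using z by (metis power2_norm_eq_inner)
  also have "\<dots> = x \<bullet> z + \<epsilon> * (F z \<bullet> z)"
    by (simp add: inner_add_left)
  also have "x \<bullet> z \<le> norm x * norm z"
    by (rule norm_cauchy_schwarz)
  also have "\<dots> \<le> (R\<^sup>2 + (norm z)\<^sup>2) / 2"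
  proof -
    have "norm x * norm z \<le> R * norm z"
      using x by (simp add: mult_right_mono)
    then show ?thesis
      using sum_squares_bound[of R "norm z"] by simp
  qed
  also have "\<epsilon> * (F z \<bullet> z) \<le> \<epsilon> * (\<delta> * R\<^sup>2 - \<delta> * (norm z)\<^sup>2)"
    using assms by (intro mult_left_mono) auto
  finally have "(1 / 2 + \<epsilon> * \<delta>) * (norm z)\<^sup>2 \<le> (1 / 2 + \<epsilon> * \<delta>) * R\<^sup>2"
    by (simp add: field_simps)
  then have "(norm z)\<^sup>2 \<le> R\<^sup>2"
    using assms by (simp add: add_pos_pos)
  then show ?thesis
    using \<open>0 \<le> R\<close> by (simp add: power2_le_iff_abs_le)
qed

section \<open>The numerical attractor of the truncated scheme\<close>

theorem theorem4p1:
  fixes lam \<mu> \<gamma> \<beta> k \<nu> p C\<^sub>p \<eta> \<epsilon> :: real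
    and g :: "int \<Rightarrow> complex"
    and m :: nat
    and ix :: "'n::finite \<Rightarrow> int"
  assumes "lam > 0" and "\<gamma> > 0" and "k > 0" and "p > 0"
    and "\<gamma> > 4 * lam"
    and "g \<in> ell ((p + 2) / (p + 1))"
    and "pow_Lipschitz_const p C\<^sub>p"
    and "\<eta> \<ge> 0"
    and "bij_betw ix UNIV {- int m..int m}"
    and "0 < \<epsilon>" and "\<epsilon> \<le> eps_star lam \<mu> \<gamma> \<beta> k \<nu> p g C\<^sub>p \<eta>"
  shows
    "let B = cball (0 :: complex ^ 'n) (r_star lam \<gamma> k p g \<eta>);
         F = scheme_field lam \<mu> \<gamma> \<beta> k \<nu> p g m ix;
         S = solution_map F \<epsilon>
     in (\<forall>y\<in>B. (\<exists>!u. scheme_solution F \<epsilon> y u) \<and>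
                (\<forall>u. scheme_solution F \<epsilon> y u \<longrightarrow> (\<forall>n. u n \<in> B))) \<and>
        (\<exists>!A. is_attractor S B A) \<and>
        is_attractor S B (\<Inter>N\<in>{1..}. closure (\<Union>n\<in>{N..}. S n ` B))"
proof -
  let ?F = "scheme_field lam \<mu> \<gamma> \<beta> k \<nu> p g m ix :: complex ^ 'n \<Rightarrow> complex ^ 'n"
  define R where "R = r_star lam \<gamma> k p g \<eta>"
  define M where "M = M_bound lam \<mu> \<gamma> \<beta> k \<nu> p g (R + 1)"
  define L where "L = L_bound lam \<mu> \<gamma> \<beta> k \<nu> p C\<^sub>p (R + 1)"
  have "c_one k p g \<ge> 0"
    using assms by (simp add: c_one_def)
  then have R: "0 \<le> R" and R2: "R\<^sup>2 = \<eta> + c_one k p g / (\<gamma> - 4 * lam)"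
    using assms by (simp_all add: R_def r_star_def)
  have c: "c_one k p g \<le> (\<gamma> - 4 * lam) * R\<^sup>2"
    using assms unfolding R2 distrib_left by simp
  have g2: "g \<in> ell 2"
    by (rule ell_mono_2[of "(p + 2) / (p + 1)"]) (use assms in \<open>auto simp: field_simps\<close>)
  have "C\<^sub>p > 0"
    using assms by (simp add: pow_Lipschitz_const_def)
  then have L: "0 \<le> L"
    using assms by (simp add: L_def L_bound_def)
  have M: "0 < M"
  proof -
    have "0 < (4 * lam + 4 * \<bar>\<mu>\<bar> + \<gamma> + \<bar>\<beta>\<bar>) * (R + 1)"
      using assms R by (intro mult_pos_pos) auto
    then show ?thesis
      using assms unfolding M_def M_bound_def ell_norm_def
      by (intro add_pos_nonneg) auto
  qed
  have "\<epsilon> \<le> 1 / M" "\<epsilon> \<le> 1 / (1 + L)"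
    using assms(11) by (auto simp: eps_star_def M_def L_def R_def)
  then have eps: "\<epsilon> * M \<le> 1" "\<epsilon> * L < 1"
    using M L assms(10) by (auto simp: field_simps)
  show ?thesis
    unfolding Let_def R_def[symmetric]
  proof (intro conjI)
    have bound: "norm (?F z) \<le> M" if "norm z \<le> R + 1" for z
      unfolding M_def using assms g2 that by (intro norm_scheme_field_le)
    have lip: "norm (?F z - ?F w) \<le> L * norm (z - w)" if "norm z \<le> R + 1" "norm w \<le> R + 1" for z w
      unfolding L_def using assms R that by (intro scheme_field_lipschitz) auto
    have apriori: "norm z \<le> R" if "norm x \<le> R" "z = x + \<epsilon> *\<^sub>R ?F z" for x z
    proof (rule dissipative_step_in_ball[where F = ?F, OF \<open>0 < \<epsilon>\<close> _ c R _ that])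
      show "?F z \<bullet> z \<le> c_one k p g - (\<gamma> - 4 * lam) * (norm z)\<^sup>2"
        using assms by (intro scheme_field_dissipative)
    qed (use assms in simp)
    note * = implicit_scheme_attractor[OF R \<open>0 < \<epsilon>\<close> eps(2,1) L bound lip apriori]
    show "\<forall>y\<in>cball 0 R. (\<exists>!u. scheme_solution ?F \<epsilon> y u) \<and> (\<forall>u. scheme_solution ?F \<epsilon> y u \<longrightarrow> (\<forall>n. u n \<in> cball 0 R))"
      by (rule *(1))
    show "\<exists>!A. is_attractor (solution_map ?F \<epsilon>) (cball 0 R) A"
      by (rule *(2))
    show "is_attractor (solution_map ?F \<epsilon>) (cball 0 R)
        (\<Inter>N\<in>{1..}. closure (\<Union>n\<in>{N..}. solution_map ?F \<epsilon> n ` cball 0 R))"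
      by (rule *(3))
  qed
qed

end
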